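(* Let $b\ge 2$ be a fixed integer. Then, as $x\to\infty$, \[\sum_{n\le x}n\log G_b(n)=-\frac{\zeta'(2b)}{2\zeta(2b)}x^2+O(x).\]
   Context: For an integer $b\ge 2$ and positive integers $m,n$, the generalized gcd is $(m,n)_b:=\max\{d\ge 1: d^b\mid m \text{ and } d^b\mid n\}$. The geometric mean of the generalized gcd function is $G_b(n):=\left(\prod_{1\le j\le n}(j,n)_b\right)^{1/n}$. Here $\zeta$ is the Riemann zeta function and $\zeta'$ its derivative, $x$ is a real variable, and sums over $n\le x$ run over positive integers $n$. *)

theory Defs
  imports "HOL-Complex_Analysis.Complex_Analysis" "HOL-Library.Landau_Symbols"
begin

(* For b >= 1 and m, n not both 0 the set is finite and contains 1; otherwise Max is unspecified. *)
definition gen_gcd :: "nat \<Rightarrow> nat \<Rightarrow> nat \<Rightarrow> nat" where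
  "gen_gcd b m n = Max {d. d \<ge> 1 \<and> d ^ b dvd m \<and> d ^ b dvd n}"

definition geom_mean_gcd :: "nat \<Rightarrow> nat \<Rightarrow> real" where
  "geom_mean_gcd b n = (\<Prod>j=1..n. real (gen_gcd b j n)) powr (1 / real n)"

(* The Riemann zeta function on the open half-plane Re s > 1, as its Dirichlet series
   (the index is shifted so that the sum starts at 1). No analytic continuation is built in:
   outside this half-plane the value is not meaningful. Since the half-plane is open, the complex
   derivative of this function at a point of it is the derivative of the zeta function there. *)
definition riemann_zeta :: "complex \<Rightarrow> complex" where
  "riemann_zeta s = (\<Sum>n. 1 / of_nat (Suc n) powr s)"

end

(* Since d^b divides both j and n exactly when d divides (j,n)_b, summing the von Mangoldt function
   over the divisors of (j,n)_b gives n log G_b(n) = sum over d^b | n of Lambda(d) n / d^b.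
   Summing over n <= x yields the sum over d of Lambda(d) T(floor(x / d^b)) with T(m) = m(m+1)/2.
   As T(floor y) differs from y^2/2 by at most y/2, this is
   (x^2/2) sum Lambda(d)/d^(2b) + O(x sum Lambda(d)/d^b), where the second series converges as b >= 2
   and the first one is -zeta'(2b)/zeta(2b). *)
theory Submission
  imports Defs "HOL-Number_Theory.Prime_Powers"
begin

section \<open>Convergence and Dirichlet product of the series of 1, log and Lambda at
  integers\<close>

lemma ln_le_two_sqrt:
  assumes "x > 0"
  shows "ln x \<le> 2 * sqrt (x::real)"
  using ln_le_minus_one[of "sqrt x"] assms by (simp add: ln_sqrt)

lemma summable_inverse_power_real:
  assumes "k \<ge> 2"
  shows "summable (\<lambda>n. 1 / real n ^ k)"
  using inverse_power_summable[OF assms, where ?'a = real] by (simp add: field_simps)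

text \<open>The logarithm costs at most a factor \<open>2 * sqrt n\<close>; even for
  \<open>k = 2\<close> this leaves the exponent -3/2, which is below -1.\<close>

lemma summable_ln_over_power:
  assumes "k \<ge> 2"
  shows "summable (\<lambda>n. ln (real n) / real n ^ k)"
proof (rule summable_comparison_test)
  show "summable (\<lambda>n. 2 * real n powr (-3/2))"
    by (intro summable_mult) (subst summable_real_powr_iff, simp)
  have "norm (ln (real n) / real n ^ k) \<le> 2 * real n powr (-3/2)" if "n \<ge> 1" for n
  proof -
    have "norm (ln (real n) / real n ^ k) = ln (real n) / real n ^ k"
      using that by simp
    also have "\<dots> \<le> (2 * sqrt (real n)) / real n ^ 2"
      using that assms by (intro frac_le ln_le_two_sqrt power_increasing) auto
    also have "\<dots> = 2 * (real n powr (1/2) / real n powr 2)"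
      using that by (simp add: powr_half_sqrt)
    also have "\<dots> = 2 * real n powr (-3/2)"
      by (subst powr_diff [symmetric]) simp
    finally show ?thesis .
  qed
  then show "\<exists>N. \<forall>n\<ge>N. norm (ln (real n) / real n ^ k) \<le> 2 * real n powr (-3/2)"
    by blast
qed

lemma summable_mangoldt_over_power:
  assumes "k \<ge> 2"
  shows "summable (\<lambda>n. mangoldt n / real n ^ k)"
proof (rule summable_comparison_test [OF _ summable_ln_over_power [OF assms]])
  show "\<exists>N. \<forall>n\<ge>N. norm (mangoldt n / real n ^ k) \<le> ln (real n) / real n ^ k"
    by (intro exI[of _ 1]) (auto simp: mangoldt_le intro!: divide_right_mono)
qed

text \<open>The terms with \<open>n = 0\<close> vanish because \<open>1 / 0 = 0\<close>.\<close>

lemma mangoldt_dirichlet_product: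
  assumes k: "k \<ge> 2"
  shows "(\<Sum>n. mangoldt n / real n ^ k) * (\<Sum>n. 1 / real n ^ k) = (\<Sum>n. ln (real n) / real n ^ k)"
proof -
  define a where "a = (\<Sum>n. mangoldt n / real n ^ k)"
  define z where "z = (\<Sum>n. 1 / real n ^ k)"
  have sumz: "summable (\<lambda>n. 1 / real n ^ k)"
    using k by (rule summable_inverse_power_real)
  have k0: "k > 0" using k by simp
  \<comment> \<open>All terms are nonnegative, so the series pass to unordered sums, which can be
    rearranged freely.\<close>
  have "((\<lambda>n. mangoldt n / real n ^ k) has_sum a) UNIV"
    using summable_mangoldt_over_power[OF k] unfolding a_def
    by (intro sums_nonneg_imp_has_sum) (auto simp: summable_sums mangoldt_nonneg)
  then have A: "((\<lambda>n. mangoldt n / real n ^ k) has_sum a) {1..}"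
    by (rule has_sum_cong_neutral[THEN iffD1, rotated -1]) (auto simp: not_le)
  have "((\<lambda>n. 1 / real n ^ k) has_sum z) UNIV"
    using sumz unfolding z_def by (intro sums_nonneg_imp_has_sum) (auto simp: summable_sums)
  then have Z: "((\<lambda>n. 1 / real n ^ k) has_sum z) {1..}"
    by (rule has_sum_cong_neutral[THEN iffD1, rotated -1]) (use k0 in \<open>auto simp: not_le\<close>)
  define f where "f = (\<lambda>(d,m). mangoldt d / real d ^ k * (1 / real m ^ k))"
  have inner: "((\<lambda>m. f (d, m)) has_sum (mangoldt d / real d ^ k * z)) {1..}" for d
    unfolding f_def prod.case by (intro has_sum_cmult_right Z)
  have outer: "((\<lambda>d. mangoldt d / real d ^ k * z) has_sum (a * z)) {1..}"
    by (intro has_sum_cmult_left A)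
  \<comment> \<open>Tonelli: for nonnegative terms, summability of the iterated sums gives
    summability over pairs.\<close>
  have "f summable_on ({1..} \<times> {1..})"
    by (rule summable_on_SigmaI[OF inner])
       (use outer in \<open>auto simp: summable_on_def f_def mangoldt_nonneg\<close>)
  then have "(f has_sum (a * z)) ({1..} \<times> {1..})"
    by (intro has_sum_SigmaI[OF inner outer])
  \<comment> \<open>Collect the pairs \<open>(d, m)\<close> by their product
    \<open>n = d * m\<close>; the inner sum over \<open>d dvd n\<close> is then the divisor sum of
    Lambda, which is \<open>ln n\<close>.\<close>
  also have "?this \<longleftrightarrow> ((\<lambda>(n,d). mangoldt d / real n ^ k) has_sum (a * z))
               (SIGMA n:{1..}. {d. d dvd n})"
    by (rule has_sum_reindex_bij_witness
          [of _ "\<lambda>(n,d). (d, n div d)" "\<lambda>(d,m). (d * m, d)"])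
       (auto simp: f_def power_mult_distrib Suc_le_eq dvd_div_eq_0_iff intro: Nat.gr0I)
  finally have "((\<lambda>n. ln (real n) / real n ^ k) has_sum (a * z)) {1..}"
  proof (rule has_sum_SigmaD)
    fix n :: nat assume n: "n \<in> {1..}"
    have "(\<Sum>d | d dvd n. mangoldt d / real n ^ k) = ln (real n) / real n ^ k"
      using n mangoldt_sum[of n, where ?'a = real] by (simp flip: sum_divide_distrib)
    moreover have "finite {d. d dvd n}" using n by simp
    ultimately show "((\<lambda>d. (case (n, d) of (n, d) \<Rightarrow> mangoldt d / real n ^ k)) has_sum
        ln (real n) / real n ^ k) {d. d dvd n}"
      by (simp add: has_sum_finite_iff)
  qed
  then have "((\<lambda>n. ln (real n) / real n ^ k) has_sum (a * z)) UNIV"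
    by (rule has_sum_cong_neutral[THEN iffD1, rotated -1]) (auto simp: not_le)
  then show ?thesis
    unfolding a_def z_def by (simp add: has_sum_imp_sums sums_unique)
qed

section \<open>Zeta, its derivative and its logarithmic derivative at integers\<close>

lemma riemann_zeta_of_nat:
  assumes "k \<ge> 2"
  shows "riemann_zeta (of_nat k) = of_real (\<Sum>n. 1 / real n ^ k)"
proof -
  have sumz: "summable (\<lambda>n. 1 / real n ^ k)"
    using assms by (rule summable_inverse_power_real)
  \<comment> \<open>The dropped term at 0 is \<open>1 / 0 ^ k = 0\<close>.\<close>
  have "(\<Sum>n. 1 / real n ^ k) = (\<Sum>n. 1 / real (Suc n) ^ k)"
    using suminf_split_head[OF sumz] assms by simp
  moreover have "summable (\<lambda>n. 1 / real (Suc n) ^ k)"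
    using sumz by (subst summable_Suc_iff)
  then have "of_real (\<Sum>n. 1 / real (Suc n) ^ k) = (\<Sum>n. of_real (1 / real (Suc n) ^ k) :: complex)"
    by (rule suminf_of_real)
  moreover have "of_real (1 / real (Suc n) ^ k) = 1 / (of_nat (Suc n) :: complex) powr of_nat k" for n
    by (subst powr_nat) (simp del: of_nat_Suc)
  ultimately show ?thesis
    unfolding riemann_zeta_def by presburger
qed

lemma deriv_riemann_zeta_of_nat:
  assumes k: "k \<ge> 4"
  shows "deriv riemann_zeta (of_nat k) = - of_real (\<Sum>n. ln (real n) / real n ^ k)"
proof -
  \<comment> \<open>An open convex half-plane containing every \<open>k \<ge> 4\<close>, the range
    of \<open>2 * b\<close> for \<open>b \<ge> 2\<close>. On it the differentiated series is
    dominated by the terms \<open>ln n / n ^ 3\<close>.\<close>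
  define S where "S = {s. Re s > 3}"
  define f where "f = (\<lambda>n s. 1 / (of_nat (Suc n) :: complex) powr s)"
  define f' where "f' = (\<lambda>n s. - of_real (ln (real (Suc n))) / (of_nat (Suc n) :: complex) powr s)"
  have kS: "of_nat k \<in> S" using k by (simp add: S_def)
  have opS: "open S" unfolding S_def by (rule open_halfspace_Re_gt)
  have der: "(f n has_field_derivative f' n s) (at s within S)" for n s
  proof -
    have "((\<lambda>s. 1 / (of_nat (Suc n) :: complex) powr s) has_field_derivative
       - (Ln (of_nat (Suc n)) * of_nat (Suc n) powr s) / (of_nat (Suc n) powr s * of_nat (Suc n) powr s)) (at s within S)"
      by (auto intro!: derivative_eq_intros DERIV_subset[OF has_field_derivative_powr_right] simp del: of_nat_Suc)
    also have "Ln (of_nat (Suc n)) = of_real (ln (real (Suc n)))"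
      by (metis Ln_of_real of_nat_0_less_iff of_real_of_nat_eq zero_less_Suc)
    finally show ?thesis
      by (simp add: f_def f'_def del: of_nat_Suc)
  qed
  have unif: "uniformly_convergent_on S (\<lambda>n s. \<Sum>i<n. f' i s)"
  proof (rule Weierstrass_m_test')
    show "summable (\<lambda>n. ln (real (Suc n)) / real (Suc n) ^ 3)"
      using summable_ln_over_power[of 3] by (subst summable_Suc_iff) simp
    fix n s assume s: "s \<in> S"
    have "norm (f' n s) = ln (real (Suc n)) / real (Suc n) powr Re s"
      by (simp add: f'_def norm_divide norm_powr_real_powr del: of_nat_Suc)
    also have "\<dots> \<le> ln (real (Suc n)) / real (Suc n) powr 3"
      using s by (intro divide_left_mono powr_mono) (auto simp: S_def)
    also have "\<dots> = ln (real (Suc n)) / real (Suc n) ^ 3"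
      by (simp del: of_nat_Suc)
    finally show "norm (f' n s) \<le> ln (real (Suc n)) / real (Suc n) ^ 3" .
  qed
  have fk: "f n (of_nat k) = of_real (1 / real (Suc n) ^ k)" for n
    unfolding f_def by (subst powr_nat) (simp del: of_nat_Suc)
  have f'k: "f' n (of_nat k) = - of_real (ln (real (Suc n)) / real (Suc n) ^ k)" for n
    unfolding f'_def by (subst powr_nat) (simp del: of_nat_Suc)
  have "summable (\<lambda>n. 1 / real n ^ k)"
    using k by (intro summable_inverse_power_real) simp
  then have "summable (\<lambda>n. 1 / real (Suc n) ^ k)"
    by (subst summable_Suc_iff)
  then have sumf: "summable (\<lambda>n. f n (of_nat k))"
    unfolding fk by (subst summable_of_real_iff)
  \<comment> \<open>Termwise differentiation needs uniform convergence of the derivatives on the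
    convex set \<open>S\<close> and convergence of the series itself at one point, here
    \<open>k\<close>.\<close>
  have "((\<lambda>s. \<Sum>n. f n s) has_field_derivative (\<Sum>n. f' n (of_nat k))) (at (of_nat k))"
    by (rule has_field_derivative_series'(2)[OF _ der unif kS sumf])
       (use kS opS in \<open>auto simp: S_def interior_open convex_halfspace_Re_gt\<close>)
  then have "(riemann_zeta has_field_derivative (\<Sum>n. f' n (of_nat k))) (at (of_nat k))"
    unfolding riemann_zeta_def f_def .
  then have "deriv riemann_zeta (of_nat k) = (\<Sum>n. f' n (of_nat k))"
    by (rule DERIV_imp_deriv)
  also have "\<dots> = - of_real (\<Sum>n. ln (real (Suc n)) / real (Suc n) ^ k)"
  proof -
    have "summable (\<lambda>n. ln (real (Suc n)) / real (Suc n) ^ k)"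
      using summable_ln_over_power[of k] k by (subst summable_Suc_iff) simp
    then show ?thesis
      unfolding f'k by (simp only: suminf_minus summable_of_real_iff suminf_of_real)
  qed
  also have "(\<Sum>n. ln (real (Suc n)) / real (Suc n) ^ k) = (\<Sum>n. ln (real n) / real n ^ k)"
    using suminf_split_head[of "\<lambda>n. ln (real n) / real n ^ k"] summable_ln_over_power[of k] k by simp
  finally show ?thesis .
qed

text \<open>Divide the Dirichlet product by zeta(k), which is positive because its terms are
  nonnegative and the one at \<open>n = 1\<close> is positive.\<close>

lemma zeta_log_derivative:
  assumes k: "k \<ge> 4"
  shows "- deriv riemann_zeta (of_nat k) / riemann_zeta (of_nat k) = of_real (\<Sum>n. mangoldt n / real n ^ k)"
proof -
  have "summable (\<lambda>n. 1 / real n ^ k)"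
    using k by (intro summable_inverse_power_real) simp
  then have "(\<Sum>n. 1 / real n ^ k) > 0"
    by (intro suminf_pos2[of _ 1]) auto
  then show ?thesis
    using mangoldt_dirichlet_product[of k] k
    by (simp add: riemann_zeta_of_nat deriv_riemann_zeta_of_nat nonzero_divide_eq_eq flip: of_real_mult)
qed

section \<open>Divisors of the generalized gcd\<close>

lemma gen_gcd_set_finite:
  assumes "b > 0" "n > 0"
  shows "finite {d::nat. d \<ge> 1 \<and> d ^ b dvd m \<and> d ^ b dvd n}"
proof (rule finite_subset)
  show "{d. d \<ge> 1 \<and> d ^ b dvd m \<and> d ^ b dvd n} \<subseteq> {..n}"
  proof safe
    fix d :: nat assume "d \<ge> 1" "d ^ b dvd n"
    then have "d dvd n" using assms by (meson dvd_power dvd_trans)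
    then show "d \<le> n" using assms by (simp add: dvd_imp_le)
  qed
qed simp

text \<open>Taking gcds commutes with powers, and gcd times lcm is the product; cancelling
  \<open>gcd d e ^ b\<close> leaves the claim. A zero gcd means \<open>d = e = 0\<close>.\<close>

lemma lcm_power_nat: "lcm (d ^ b) (e ^ b) = lcm d e ^ b" for d e :: nat
proof (cases "gcd d e = 0")
  case False
  have "gcd d e ^ b * lcm (d ^ b) (e ^ b) = gcd d e ^ b * lcm d e ^ b"
    by (metis gcd_exp power_mult_distrib prod_gcd_lcm_nat)
  then show ?thesis using False by auto
qed (cases "b = 0"; simp)

text \<open>The set under the maximum is closed under lcm, so its largest element is a multiple of
  every other element.\<close>

lemma dvd_gen_gcd_iff:
  assumes b: "b > 0" and n: "n > 0"
  shows "d dvd gen_gcd b m n \<longleftrightarrow> d ^ b dvd m \<and> d ^ b dvd n"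
proof -
  define A where "A = {d::nat. d \<ge> 1 \<and> d ^ b dvd m \<and> d ^ b dvd n}"
  define g where "g = gen_gcd b m n"
  have g: "g = Max A" by (simp add: g_def gen_gcd_def A_def)
  have fin: "finite A" unfolding A_def by (rule gen_gcd_set_finite[OF b n])
  have "1 \<in> A" by (simp add: A_def)
  then have gA: "g \<in> A" unfolding g using fin by (intro Max_in) auto
  show ?thesis unfolding g_def[symmetric]
  proof
    assume "d dvd g"
    then have "d ^ b dvd g ^ b" using b by simp
    then show "d ^ b dvd m \<and> d ^ b dvd n"
      using gA unfolding A_def by (auto intro: dvd_trans)
  next
    assume d: "d ^ b dvd m \<and> d ^ b dvd n"
    then have "d \<noteq> 0" using b n by (metis dvd_0_left_iff less_numeral_extra(3) power_eq_0_iff)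
    then have "lcm d g \<in> A"
      using d gA unfolding A_def by (auto simp: Suc_le_eq lcm_pos_nat simp flip: lcm_power_nat)
    then have "lcm d g \<le> g" unfolding g using fin by (intro Max_ge)
    moreover have "g > 0" using gA by (simp add: A_def)
    ultimately have "lcm d g = g"
      using \<open>d \<noteq> 0\<close> by (metis dvd_imp_le dvd_lcm2 lcm_pos_nat le_antisym neq0_conv)
    then show "d dvd g" by (metis dvd_lcm1)
  qed
qed

lemma gen_gcd_pos:
  assumes "b > 0" "n > 0"
  shows "gen_gcd b m n > 0"
proof (rule ccontr)
  assume "\<not> gen_gcd b m n > 0"
  \<comment> \<open>Take \<open>d = 0\<close> in the divisor criterion: 0 divides only 0.\<close>
  then have "0 ^ b dvd n" using dvd_gen_gcd_iff[of b n 0 m] assms by simp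
  then show False using assms by (simp add: zero_power)
qed

lemma ln_gen_gcd:
  assumes "b > 0" "n > 0"
  shows "ln (real (gen_gcd b m n)) = (\<Sum>d | d ^ b dvd m \<and> d ^ b dvd n. mangoldt d)"
  using mangoldt_sum[of "gen_gcd b m n", where ?'a = real] gen_gcd_pos[OF assms, of m]
  by (simp add: dvd_gen_gcd_iff[OF assms])

section \<open>From the geometric mean to divisor sums of Lambda\<close>

lemma card_multiples:
  assumes "q dvd n" "n > 0"
  shows "card {j\<in>{1..n}. q dvd j} = n div (q::nat)"
proof -
  have q: "q > 0" using assms by (auto intro: Nat.gr0I)
  have "{j\<in>{1..n}. q dvd j} = (\<lambda>i. q * i) ` {1..n div q}"
  proof safe
    fix j assume j: "j \<in> {1..n}" "q dvd j"
    then have "j = q * (j div q)" "j div q \<in> {1..n div q}"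
      using q by (auto simp: div_le_mono Suc_le_eq dvd_imp_le div_greater_zero_iff)
    then show "j \<in> (\<lambda>i. q * i) ` {1..n div q}" by blast
  qed (use q in \<open>auto simp: Suc_le_eq less_eq_div_iff_mult_less_eq mult.commute\<close>)
  then show ?thesis using q by (simp add: card_image inj_on_def)
qed

lemma ln_geom_mean_gcd:
  assumes b: "b > 0" and n: "n > 0"
  shows "real n * ln (geom_mean_gcd b n) = (\<Sum>d | d ^ b dvd n. mangoldt d * real (n div d ^ b))"
proof -
  have fin: "finite {d. d ^ b dvd n}"
    by (rule finite_subset[OF _ gen_gcd_set_finite[OF b n, of n]])
       (use b n in \<open>auto simp: Suc_le_eq intro!: Nat.gr0I\<close>)
  have "real n * ln (geom_mean_gcd b n) = (\<Sum>j=1..n. ln (real (gen_gcd b j n)))"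
  proof -
    have "(\<Prod>j=1..n. real (gen_gcd b j n)) > 0"
      using gen_gcd_pos[OF b n] by (intro prod_pos) auto
    then show ?thesis
      using n gen_gcd_pos[OF b n] by (simp add: geom_mean_gcd_def ln_powr ln_prod)
  qed
  \<comment> \<open>With the condition on \<open>j\<close> as an indicator, the range of
    \<open>d\<close> depends on \<open>n\<close> alone and the sums can be swapped; each
    \<open>d\<close> is then counted once per multiple of \<open>d ^ b\<close> up to
    \<open>n\<close>.\<close>
  also have "\<dots> = (\<Sum>j=1..n. \<Sum>d | d ^ b dvd n. if d ^ b dvd j then mangoldt d else 0)"
    using fin by (simp add: ln_gen_gcd[OF b n] sum.If_cases Int_def conj_commute)
  also have "\<dots> = (\<Sum>d | d ^ b dvd n. \<Sum>j=1..n. if d ^ b dvd j then mangoldt d else 0)"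
    by (rule sum.swap)
  also have "\<dots> = (\<Sum>d | d ^ b dvd n. mangoldt d * real (n div d ^ b))"
  proof (intro sum.cong refl)
    fix d assume "d \<in> {d. d ^ b dvd n}"
    then have "card {j\<in>{1..n}. d ^ b dvd j} = n div d ^ b"
      using n by (intro card_multiples) auto
    then show "(\<Sum>j=1..n. if d ^ b dvd j then mangoldt d else 0) = mangoldt d * real (n div d ^ b)"
      by (simp add: mult.commute flip: sum.inter_filter)
  qed
  finally show ?thesis .
qed

text \<open>The multiples of \<open>q\<close> up to \<open>N\<close> have the cofactors
  \<open>1, ..., N div q\<close>, whose sum is a triangular number.\<close>

lemma sum_cofactors:
  assumes q: "q > (0::nat)"
  shows "(\<Sum>n | n \<in> {1..N} \<and> q dvd n. real (n div q)) = real (N div q) * (real (N div q) + 1) / 2"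
proof -
  have "(\<Sum>n | n \<in> {1..N} \<and> q dvd n. real (n div q)) = (\<Sum>i=1..N div q. real i)"
    by (rule sum.reindex_bij_witness[of _ "\<lambda>i. q * i" "\<lambda>n. n div q"])
       (use q in \<open>auto simp: Suc_le_eq div_le_mono dvd_imp_le div_greater_zero_iff less_eq_div_iff_mult_less_eq mult.commute\<close>)
  also have "\<dots> = real (N div q) * (real (N div q) + 1) / 2"
    using double_gauss_sum_from_Suc_0[of "N div q", where ?'a = real] by simp
  finally show ?thesis .
qed

section \<open>The summatory function and its error term\<close>

text \<open>The sum over \<open>d\<close> is effectively finite, since
  \<open>N div d ^ b = 0\<close> for \<open>d > N\<close>. Writing it as a series over all
  \<open>d\<close> permits termwise comparison with the Dirichlet series of Lambda.\<close>

lemma sum_ln_geom_mean_gcd: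
  assumes b: "b > 0"
  shows "(\<lambda>d. mangoldt d * (real (N div d ^ b) * (real (N div d ^ b) + 1) / 2)) sums
           (\<Sum>n=1..N. real n * ln (geom_mean_gcd b n))"
proof -
  \<comment> \<open>Gives a common range of \<open>d\<close> for all \<open>n\<close>, so that the
    two sums can be swapped.\<close>
  have le: "d \<le> N" if "d ^ b dvd n" "n \<in> {1..N}" for d n
    using that b by (metis atLeastAtMost_iff dvd_imp_le dvd_power dvd_trans le_trans less_le_trans zero_less_one)
  have "(\<Sum>n=1..N. real n * ln (geom_mean_gcd b n)) =
      (\<Sum>n=1..N. \<Sum>d | d ^ b dvd n. mangoldt d * real (n div d ^ b))"
    using b by (intro sum.cong ln_geom_mean_gcd) auto
  also have "\<dots> = (\<Sum>n=1..N. \<Sum>d\<le>N. if d ^ b dvd n then mangoldt d * real (n div d ^ b) else 0)"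
    using le by (intro sum.cong refl sum.mono_neutral_cong_left) auto
  also have "\<dots> = (\<Sum>d\<le>N. \<Sum>n=1..N. if d ^ b dvd n then mangoldt d * real (n div d ^ b) else 0)"
    by (rule sum.swap)
  also have "\<dots> = (\<Sum>d\<le>N. mangoldt d * (real (N div d ^ b) * (real (N div d ^ b) + 1) / 2))"
  proof (intro sum.cong refl)
    fix d
    show "(\<Sum>n=1..N. if d ^ b dvd n then mangoldt d * real (n div d ^ b) else 0) =
        mangoldt d * (real (N div d ^ b) * (real (N div d ^ b) + 1) / 2)"
    \<comment> \<open>For \<open>d = 0\<close> both sides vanish because
      \<open>mangoldt 0 = 0\<close>; the cofactor sum requires a positive divisor.\<close>
    proof (cases "d = 0")
      case True
      then show ?thesis by (simp cong: if_cong)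
    next
      case False
      have "(\<Sum>n=1..N. if d ^ b dvd n then mangoldt d * real (n div d ^ b) else 0) =
          (\<Sum>n | n \<in> {1..N} \<and> d ^ b dvd n. mangoldt d * real (n div d ^ b))"
        by (rule sum.inter_filter [symmetric, simplified]) auto
      then show ?thesis
        using sum_cofactors[of "d ^ b" N] False by (simp flip: sum_distrib_left)
    qed
  qed
  finally have "(\<Sum>n=1..N. real n * ln (geom_mean_gcd b n)) =
     (\<Sum>d\<le>N. mangoldt d * (real (N div d ^ b) * (real (N div d ^ b) + 1) / 2))" .
  moreover have "N div d ^ b = 0" if "d > N" for d
  proof -
    have "d ^ 1 \<le> d ^ b" using that b by (intro power_increasing) auto
    then show ?thesis using that by simp
  qed
  ultimately show ?thesis
    by (simp only:) (rule sums_finite, auto)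
qed

text \<open>The bound has no constant term even for \<open>y < 1\<close>, so it can be summed over all \<open>d\<close>
  without truncating at \<open>d ^ b \<le> x\<close>.\<close>

lemma triangular_floor_bound:
  assumes "real K \<le> y" "y < real K + 1"
  shows "\<bar>real K * (real K + 1) / 2 - y\<^sup>2 / 2\<bar> \<le> y / 2"
proof -
  \<comment> \<open>This bound and the next confine \<open>K * (K + 1)\<close> to the interval from
    \<open>y * (y - 1)\<close> to \<open>y * (y + 1)\<close>, that is, to within \<open>y\<close> of
    the square of \<open>y\<close>.\<close>
  have "real K * (real K + 1) \<le> y * (y + 1)"
    using assms by (intro mult_mono) auto
  moreover have "y * (y - 1) \<le> real K * (real K + 1)"
  proof -
    have "(y - 1) * y \<le> real K * y" using assms by (intro mult_right_mono) auto
    also have "\<dots> \<le> real K * (real K + 1)" using assms by (intro mult_left_mono) auto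
    finally show ?thesis by (simp add: mult.commute)
  qed
  ultimately show ?thesis
    by (simp add: abs_le_iff power2_eq_square field_simps)
qed

lemma sum_ln_geom_mean_gcd_bound:
  assumes b: "b \<ge> 2" and x: "x \<ge> 0"
  shows "\<bar>(\<Sum>n | n \<ge> 1 \<and> real n \<le> x. real n * ln (geom_mean_gcd b n))
            - (\<Sum>d. mangoldt d / real d ^ (2 * b)) / 2 * x\<^sup>2\<bar>
         \<le> (\<Sum>d. mangoldt d / real d ^ b) / 2 * x"
proof -
  define N where "N = nat \<lfloor>x\<rfloor>"
  define t where "t = (\<lambda>d. real (N div d ^ b) * (real (N div d ^ b) + 1) / 2)"
  have N: "real N \<le> x" "x < real N + 1" using x by (auto simp: N_def)
  have set_eq: "{n. n \<ge> 1 \<and> real n \<le> x} = {1..N}"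
    using x by (auto simp: N_def le_nat_iff le_floor_iff)
  have S1: "(\<lambda>d. mangoldt d * t d) sums (\<Sum>n=1..N. real n * ln (geom_mean_gcd b n))"
    unfolding t_def using b by (intro sum_ln_geom_mean_gcd) auto
  have S2: "(\<lambda>d. mangoldt d / real d ^ (2 * b) / 2 * x\<^sup>2) sums ((\<Sum>d. mangoldt d / real d ^ (2 * b)) / 2 * x\<^sup>2)"
    using b by (intro sums_mult2 sums_divide summable_sums summable_mangoldt_over_power) auto
  have S3: "(\<lambda>d. mangoldt d / real d ^ b / 2 * x) sums ((\<Sum>d. mangoldt d / real d ^ b) / 2 * x)"
    using b by (intro sums_mult2 sums_divide summable_sums summable_mangoldt_over_power) auto
  have bound: "\<bar>mangoldt d * t d - mangoldt d / real d ^ (2 * b) / 2 * x\<^sup>2\<bar> \<le> mangoldt d / real d ^ b / 2 * x" for d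
  proof (cases "d = 0")
    case False
    define y where "y = x / real d ^ b"
    define K where "K = N div d ^ b"
    have p: "real d ^ b > 0" using False by simp
    \<comment> \<open>Nested floors: \<open>K\<close> is the integer part of
      \<open>y = x / d ^ b\<close>, although it is computed from the integer part \<open>N\<close>
      of \<open>x\<close>.\<close>
    have "real K * real (d ^ b) \<le> real N"
      unfolding K_def of_nat_mult[symmetric] of_nat_le_iff by simp
    then have 1: "real K \<le> y" using p N by (simp add: y_def pos_le_divide_eq)
    have "N < (K + 1) * d ^ b"
      using False unfolding K_def by (metis Suc_eq_plus1 dividend_less_times_div mult.commute mult_Suc neq0_conv power_eq_0_iff)
    \<comment> \<open>Integrality gains the 1 that absorbs the fractional part of
      \<open>x\<close>.\<close>
    then have "N + 1 \<le> (K + 1) * d ^ b" by simp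
    then have "real (N + 1) \<le> real ((K + 1) * d ^ b)" by (rule of_nat_mono)
    then have "x < (real K + 1) * real d ^ b"
      using N by (simp add: algebra_simps)
    then have 2: "y < real K + 1"
      using p by (simp add: y_def pos_divide_less_eq)
    have "\<bar>mangoldt d * t d - mangoldt d / real d ^ (2 * b) / 2 * x\<^sup>2\<bar>
        = mangoldt d * \<bar>t d - y\<^sup>2 / 2\<bar>"
    proof -
      have "mangoldt d * t d - mangoldt d / real d ^ (2 * b) / 2 * x\<^sup>2 = mangoldt d * (t d - y\<^sup>2 / 2)"
        by (simp add: y_def power_divide power_even_eq right_diff_distrib)
      then show ?thesis by (simp add: abs_mult)
    qed
    also have "\<dots> \<le> mangoldt d * (y / 2)"
      using triangular_floor_bound[OF 1 2] unfolding t_def K_def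
      by (intro mult_left_mono mangoldt_nonneg) auto
    finally show ?thesis by (simp add: y_def)
  qed simp
  let ?D = "(\<Sum>n=1..N. real n * ln (geom_mean_gcd b n)) - (\<Sum>d. mangoldt d / real d ^ (2 * b)) / 2 * x\<^sup>2"
  have D: "(\<lambda>d. mangoldt d * t d - mangoldt d / real d ^ (2 * b) / 2 * x\<^sup>2) sums ?D"
    by (rule sums_diff[OF S1 S2])
  \<comment> \<open>The termwise bound on the absolute value is summed as two one-sided comparisons,
    for \<open>?D\<close> and for \<open>- ?D\<close>.\<close>
  have "?D \<le> (\<Sum>d. mangoldt d / real d ^ b) / 2 * x"
    by (rule sums_le[OF _ D S3]) (use bound abs_le_iff in blast)
  moreover have "- ?D \<le> (\<Sum>d. mangoldt d / real d ^ b) / 2 * x"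
    by (rule sums_le[OF _ sums_minus[OF D] S3]) (use bound abs_le_iff in blast)
  ultimately show ?thesis unfolding set_eq by (rule abs_leI)
qed

theorem theorem1p5:
  fixes b :: nat
  assumes "b \<ge> 2"
  shows "(\<lambda>x::real.
           complex_of_real (\<Sum>n | n \<ge> 1 \<and> real n \<le> x. real n * ln (geom_mean_gcd b n))
           - (- deriv riemann_zeta (of_nat (2 * b)) / (2 * riemann_zeta (of_nat (2 * b))))
               * complex_of_real x ^ 2)
         \<in> O[at_top](\<lambda>x. complex_of_real x)"
proof -
  \<comment> \<open>\<open>c\<close> is the real value of -zeta'(2b)/zeta(2b). With a real main
    coefficient, the complex estimate reduces to the real bound for
    \<open>x \<ge> 0\<close>.\<close>
  define c where "c = (\<Sum>d. mangoldt d / real d ^ (2 * b))"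
  have "- deriv riemann_zeta (of_nat (2 * b)) / (2 * riemann_zeta (of_nat (2 * b))) =
      (- deriv riemann_zeta (of_nat (2 * b)) / riemann_zeta (of_nat (2 * b))) / 2"
    by (simp only: divide_divide_eq_left mult.commute)
  also have "\<dots> = of_real (c / 2)"
    using zeta_log_derivative[of "2 * b"] assms by (simp add: c_def del: of_nat_mult)
  finally have c: "- deriv riemann_zeta (of_nat (2 * b)) / (2 * riemann_zeta (of_nat (2 * b))) = of_real (c / 2)" .
  show ?thesis unfolding c
  proof (rule bigoI)
    show "\<forall>\<^sub>F x in at_top. norm (complex_of_real (\<Sum>n | n \<ge> 1 \<and> real n \<le> x. real n * ln (geom_mean_gcd b n))
           - of_real (c / 2) * complex_of_real x ^ 2)
        \<le> (\<Sum>d. mangoldt d / real d ^ b) / 2 * norm (complex_of_real x)"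
      using eventually_ge_at_top[of "0::real"]
    proof eventually_elim
      case (elim x)
      then show ?case
        using sum_ln_geom_mean_gcd_bound[OF assms elim] unfolding c_def[symmetric]
        by (simp only: norm_of_real abs_of_nonneg flip: of_real_mult of_real_power of_real_diff)
    qed
  qed
qed

end
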